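(* The class of (countably infinite) prefix trees is not punctually robust: there is a computable prefix tree not isomorphic to any punctual prefix tree.
   Context: A prefix tree is a structure $\mathcal T=(T,R_1,R_2,R_3,\dots;r)$ in the infinite signature where each $R_n$ is an $n$-ary relation and $r\in T$, satisfying: (1) $R_1=\{r\}$; (2) if $R_n(a_1,\dots,a_n)$ and $1\le i\le n$ then $R_i(a_1,\dots,a_i)$. A structure with such an infinite signature is computable if its domain is a computable subset of $\mathbb N$ and the relations are uniformly computable. It is punctual if its domain is $\mathbb N$, all relations and constants are uniformly primitive recursive, and the function assigning to the index of a relation its arity is primitive recursive. A class is punctually robust if every computable member is isomorphic to a punctual structure. *)

theory Defs
  imports Main "HOL-Library.Nat_Bijection"
begin

text \<open>
  A \<open>k\<close>-ary function on the natural numbers is represented by a function on argument lists, of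
  which only the values on lists of length \<open>k\<close> are meaningful.
\<close>

inductive primrec_fn :: "nat \<Rightarrow> (nat list \<Rightarrow> nat) \<Rightarrow> bool" where
  zero: "primrec_fn k (\<lambda>_. 0)"
| succ: "primrec_fn 1 (\<lambda>xs. Suc (hd xs))"
| proj: "i < k \<Longrightarrow> primrec_fn k (\<lambda>xs. xs ! i)"
| comp: "primrec_fn (length fs) g \<Longrightarrow> \<forall>f \<in> set fs. primrec_fn k f \<Longrightarrow>
    primrec_fn k (\<lambda>xs. g (map (\<lambda>f. f xs) fs))"
| prec: "primrec_fn k g \<Longrightarrow> primrec_fn (Suc (Suc k)) h \<Longrightarrow>
    primrec_fn (Suc k) (\<lambda>xs. rec_nat (g (tl xs)) (\<lambda>n y. h (n # y # tl xs)) (hd xs))"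

text \<open>
  The total computable functions, as the general recursive functions: minimization is applied only
  to regular functions, so that all functions involved are total.
\<close>

inductive computable_fn :: "nat \<Rightarrow> (nat list \<Rightarrow> nat) \<Rightarrow> bool" where
  zero: "computable_fn k (\<lambda>_. 0)"
| succ: "computable_fn 1 (\<lambda>xs. Suc (hd xs))"
| proj: "i < k \<Longrightarrow> computable_fn k (\<lambda>xs. xs ! i)"
| comp: "computable_fn (length fs) g \<Longrightarrow> \<forall>f \<in> set fs. computable_fn k f \<Longrightarrow>
    computable_fn k (\<lambda>xs. g (map (\<lambda>f. f xs) fs))"
| prec: "computable_fn k g \<Longrightarrow> computable_fn (Suc (Suc k)) h \<Longrightarrow>
    computable_fn (Suc k) (\<lambda>xs. rec_nat (g (tl xs)) (\<lambda>n y. h (n # y # tl xs)) (hd xs))"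
| mini: "computable_fn (Suc k) f \<Longrightarrow> \<forall>xs. length xs = k \<longrightarrow> (\<exists>n. f (n # xs) = 0) \<Longrightarrow>
    computable_fn k (\<lambda>xs. LEAST n. f (n # xs) = 0)"

text \<open>
  Structures in a signature with one constant symbol and relation symbols numbered
  \<open>0, 1, 2, \<dots>\<close>, the \<open>i\<close>-th of which has arity \<open>ar i\<close>; an \<open>n\<close>-ary relation is a set of lists of
  length \<open>n\<close>.
\<close>

record 'a struct =
  univ :: "'a set"
  rel :: "nat \<Rightarrow> 'a list set"
  cst :: 'a

definition is_struct :: "(nat \<Rightarrow> nat) \<Rightarrow> 'a struct \<Rightarrow> bool" where
  "is_struct ar A \<longleftrightarrow> cst A \<in> univ A \<and>
     (\<forall>i. \<forall>xs \<in> rel A i. length xs = ar i \<and> set xs \<subseteq> univ A)"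

definition struct_iso :: "(nat \<Rightarrow> nat) \<Rightarrow> 'a struct \<Rightarrow> 'b struct \<Rightarrow> bool" where
  "struct_iso ar A B \<longleftrightarrow> (\<exists>h. bij_betw h (univ A) (univ B) \<and> h (cst A) = cst B \<and>
     (\<forall>i xs. length xs = ar i \<and> set xs \<subseteq> univ A \<longrightarrow> (xs \<in> rel A i \<longleftrightarrow> map h xs \<in> rel B i)))"

definition computable_struct :: "(nat \<Rightarrow> nat) \<Rightarrow> nat struct \<Rightarrow> bool" where
  "computable_struct ar A \<longleftrightarrow> is_struct ar A \<and>
     (\<exists>d. computable_fn 1 d \<and> (\<forall>x. d [x] = of_bool (x \<in> univ A))) \<and>
     (\<exists>c. computable_fn 2 c \<and>
       (\<forall>i xs. length xs = ar i \<longrightarrow> c [i, list_encode xs] = of_bool (xs \<in> rel A i)))"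

text \<open>A single constant is trivially primitive recursive, so no condition on it appears.\<close>

definition punctual_struct :: "(nat \<Rightarrow> nat) \<Rightarrow> nat struct \<Rightarrow> bool" where
  "punctual_struct ar A \<longleftrightarrow> is_struct ar A \<and> univ A = UNIV \<and>
     (\<exists>c. primrec_fn 2 c \<and>
       (\<forall>i xs. length xs = ar i \<longrightarrow> c [i, list_encode xs] = of_bool (xs \<in> rel A i))) \<and>
     (\<exists>a. primrec_fn 1 a \<and> (\<forall>i. a [i] = ar i))"

definition punctually_robust :: "(nat \<Rightarrow> nat) \<Rightarrow> nat struct set \<Rightarrow> bool" where
  "punctually_robust ar K \<longleftrightarrow>
     (\<forall>A \<in> K. computable_struct ar A \<longrightarrow> (\<exists>B. punctual_struct ar B \<and> struct_iso ar A B))"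

text \<open>The relation \<open>R\<^sub>n\<close> of a prefix tree, \<open>n \<ge> 1\<close>, is the one with index \<open>n - 1\<close>; so \<open>ar = Suc\<close>.\<close>

definition prefix_tree :: "'a struct \<Rightarrow> bool" where
  "prefix_tree A \<longleftrightarrow> is_struct Suc A \<and> rel A 0 = {[cst A]} \<and>
     (\<forall>n. \<forall>xs \<in> rel A n. \<forall>i \<le> n. take (Suc i) xs \<in> rel A i)"

end

theory Submission
  imports Defs
begin

text \<open>
  Let \<open>S\<close> be a computable set that is not primitive recursive, and let \<open>A\<close> be the prefix tree on
  the natural numbers whose sequences are all \<open>0\<^sup>n\<close>, together with \<open>0\<^sup>n\<^sup>+\<^sup>1 1\<close> for every \<open>n \<in> S\<close>.
  An isomorphism onto a punctual \<open>B\<close> sends \<open>0\<close> and \<open>1\<close> to fixed numbers \<open>r\<close> and \<open>b\<close>, so membership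
  of \<open>n\<close> in \<open>S\<close> could be decided primitive recursively by asking \<open>B\<close> about \<open>r\<^sup>n\<^sup>+\<^sup>1 b\<close>.

  The set \<open>S\<close> diagonalises against a stack machine that evaluates codes of unary primitive
  recursive functions: one step of the machine is a computable operation, the machine halts on every
  code and every input, and every primitive recursive function has a code.
\<close>

abbreviation pr :: "nat \<Rightarrow> nat \<Rightarrow> nat" where
  "pr a b \<equiv> prod_encode (a, b)"

abbreviation p1 :: "nat \<Rightarrow> nat" where
  "p1 n \<equiv> fst (prod_decode n)"

abbreviation p2 :: "nat \<Rightarrow> nat" where
  "p2 n \<equiv> snd (prod_decode n)"

section \<open>Computable functions\<close>

text \<open>
  \<open>computable_fn\<close> constrains a function on lists of every length; \<open>cmp k\<close> ignores the values on
  lists of length other than \<open>k\<close>.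
\<close>

definition cmp :: "nat \<Rightarrow> (nat list \<Rightarrow> nat) \<Rightarrow> bool" where
  "cmp k f \<longleftrightarrow> (\<exists>g. computable_fn k g \<and> (\<forall>xs. length xs = k \<longrightarrow> g xs = f xs))"

lemma cmp_cong:
  assumes "cmp k f" "\<And>xs. length xs = k \<Longrightarrow> f xs = g xs"
  shows "cmp k g"
  using assms unfolding cmp_def by metis

lemma cmp_proj: "i < k \<Longrightarrow> cmp k (\<lambda>xs. xs ! i)"
  unfolding cmp_def using computable_fn.proj by blast

lemma cmp_comp:
  assumes "cmp (length fs) g" "\<And>f. f \<in> set fs \<Longrightarrow> cmp k f"
  shows "cmp k (\<lambda>xs. g (map (\<lambda>f. f xs) fs))"
proof -
  obtain g' where g': "computable_fn (length fs) g'" "\<And>xs. length xs = length fs \<Longrightarrow> g' xs = g xs"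
    using assms(1) unfolding cmp_def by blast
  obtain c where c: "\<And>f. f \<in> set fs \<Longrightarrow> computable_fn k (c f)"
    "\<And>f xs. f \<in> set fs \<Longrightarrow> length xs = k \<Longrightarrow> c f xs = f xs"
    using assms(2) unfolding cmp_def by metis
  have "computable_fn k (\<lambda>xs. g' (map (\<lambda>f. f xs) (map c fs)))"
    by (rule computable_fn.comp) (use g' c in auto)
  moreover have "g' (map (\<lambda>f. f xs) (map c fs)) = g (map (\<lambda>f. f xs) fs)" if "length xs = k" for xs
  proof -
    have "map (\<lambda>f. f xs) (map c fs) = map (\<lambda>f. f xs) fs"
      using c(2) that by simp
    then show ?thesis using g'(2) by (simp del: map_map)
  qed
  ultimately show ?thesis unfolding cmp_def by blast
qed

lemma cmp_comp1:
  assumes "cmp 1 (\<lambda>xs. F (xs ! 0))" "cmp k f"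
  shows "cmp k (\<lambda>xs. F (f xs))"
  using cmp_comp[of "[f]" "\<lambda>xs. F (xs ! 0)" k] assms by simp

lemma cmp_comp2:
  assumes "cmp 2 (\<lambda>xs. F (xs ! 0) (xs ! 1))" "cmp k f" "cmp k g"
  shows "cmp k (\<lambda>xs. F (f xs) (g xs))"
  using cmp_comp[of "[f, g]" "\<lambda>xs. F (xs ! 0) (xs ! 1)" k] assms
  by (auto simp: numeral_2_eq_2)

lemma cmp_comp3:
  assumes "cmp 3 (\<lambda>xs. F (xs ! 0) (xs ! 1) (xs ! 2))" "cmp k f" "cmp k g" "cmp k h"
  shows "cmp k (\<lambda>xs. F (f xs) (g xs) (h xs))"
  using cmp_comp[of "[f, g, h]" "\<lambda>xs. F (xs ! 0) (xs ! 1) (xs ! 2)" k] assms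
  by (auto simp: numeral_2_eq_2 numeral_3_eq_3)

lemma cmp_Suc:
  assumes "cmp k f"
  shows "cmp k (\<lambda>xs. Suc (f xs))"
proof (rule cmp_comp1[OF _ assms])
  show "cmp 1 (\<lambda>xs. Suc (xs ! 0))"
    unfolding cmp_def
    by (rule exI[of _ "\<lambda>xs. Suc (hd xs)"])
      (auto intro: computable_fn.succ[unfolded One_nat_def] simp: length_Suc_conv)
qed

lemma cmp_const: "cmp k (\<lambda>_. n)"
proof (induction n)
  case 0
  show ?case unfolding cmp_def using computable_fn.zero by blast
next
  case (Suc n)
  then show ?case by (rule cmp_Suc)
qed

lemma cmp_rec:
  assumes N: "cmp k N" and G: "cmp k G"
    and H: "cmp (Suc (Suc k)) (\<lambda>zs. H (zs ! 0) (zs ! 1) (drop 2 zs))"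
  shows "cmp k (\<lambda>xs. rec_nat (G xs) (\<lambda>n y. H n y xs) (N xs))"
proof -
  obtain g where g: "computable_fn k g" "\<And>xs. length xs = k \<Longrightarrow> g xs = G xs"
    using G unfolding cmp_def by blast
  obtain h where h: "computable_fn (Suc (Suc k)) h"
    "\<And>xs. length xs = Suc (Suc k) \<Longrightarrow> h xs = H (xs ! 0) (xs ! 1) (drop 2 xs)"
    using H unfolding cmp_def by blast
  let ?r = "\<lambda>xs. rec_nat (g (tl xs)) (\<lambda>n y. h (n # y # tl xs)) (hd xs)"
  \<comment> \<open>\<open>prec\<close> recurses on the head of its argument list; prepending
    \<open>N xs\<close> to an unchanged \<open>xs\<close> frees the recursion bound.\<close>
  let ?fs = "N # map (\<lambda>i xs. xs ! i) [0..<k]"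
  have "cmp (length ?fs) ?r"
    using computable_fn.prec[OF g(1) h(1)] unfolding cmp_def by auto
  then have "cmp k (\<lambda>xs. ?r (map (\<lambda>f. f xs) ?fs))"
    by (rule cmp_comp) (use N in \<open>auto intro: cmp_proj\<close>)
  moreover have "?r (map (\<lambda>f. f xs) ?fs) = rec_nat (G xs) (\<lambda>n y. H n y xs) (N xs)"
    if "length xs = k" for xs
  proof -
    have "map (\<lambda>f. f xs) ?fs = N xs # xs"
      using that map_nth[of xs] by (simp add: comp_def)
    then show ?thesis using g(2) h(2) that by simp
  qed
  ultimately show ?thesis by (rule cmp_cong)
qed

lemma cmp_Least:
  assumes "cmp (Suc k) (\<lambda>zs. f (zs ! 0) (tl zs))"
    and "\<And>xs. length xs = k \<Longrightarrow> \<exists>n. f n xs = 0"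
  shows "cmp k (\<lambda>xs. LEAST n. f n xs = 0)"
proof -
  obtain g where g: "computable_fn (Suc k) g"
    "\<And>xs. length xs = Suc k \<Longrightarrow> g xs = f (xs ! 0) (tl xs)"
    using assms(1) unfolding cmp_def by blast
  have "computable_fn k (\<lambda>xs. LEAST n. g (n # xs) = 0)"
    using computable_fn.mini[OF g(1)] g(2) assms(2) by simp
  then show ?thesis unfolding cmp_def using g(2) by (intro exI conjI) auto
qed

section \<open>Arithmetic, case distinction and Cantor pairing\<close>

lemma cmp_add:
  assumes "cmp k f" "cmp k g"
  shows "cmp k (\<lambda>xs. f xs + g xs)"
proof (rule cmp_comp2[OF _ assms])
  have "cmp 2 (\<lambda>xs. rec_nat (xs ! 1) (\<lambda>n y. Suc y) (xs ! 0))"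
    by (intro cmp_rec cmp_Suc cmp_proj) auto
  moreover have "rec_nat b (\<lambda>n y. Suc y) a = a + b" for a b :: nat
    by (induction a) auto
  ultimately show "cmp 2 (\<lambda>xs. xs ! 0 + xs ! 1)" by simp
qed

lemma cmp_diff:
  assumes "cmp k f" "cmp k g"
  shows "cmp k (\<lambda>xs. f xs - g xs)"
proof (rule cmp_comp2[OF _ assms])
  have "cmp 1 (\<lambda>xs. rec_nat 0 (\<lambda>n y. n) (xs ! 0))"
    by (intro cmp_rec cmp_const cmp_proj) auto
  moreover have "rec_nat 0 (\<lambda>n y. n) a = a - 1" for a :: nat
    by (cases a) auto
  ultimately have pred: "cmp 1 (\<lambda>xs. xs ! 0 - 1)" by simp
  have "cmp 2 (\<lambda>xs. rec_nat (xs ! 0) (\<lambda>n y. y - 1) (xs ! 1))"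
    by (intro cmp_rec cmp_comp1[OF pred] cmp_proj) auto
  moreover have "rec_nat a (\<lambda>n y. y - 1) b = a - b" for a b :: nat
    by (induction b) auto
  ultimately show "cmp 2 (\<lambda>xs. xs ! 0 - xs ! 1)" by simp
qed

lemma cmp_if_eq:
  assumes "cmp k f" "cmp k g" "cmp k h" "cmp k i"
  shows "cmp k (\<lambda>xs. if f xs = g xs then h xs else i xs)"
proof -
  have "cmp 3 (\<lambda>xs. rec_nat (xs ! 1) (\<lambda>n y. xs ! 2) (xs ! 0))"
  proof (intro cmp_rec cmp_proj)
    show "cmp (Suc (Suc 3)) (\<lambda>zs. drop 2 zs ! 2)"
      by (rule cmp_cong[OF cmp_proj[of 4]]) auto
  qed auto
  moreover have "rec_nat b (\<lambda>n y. c) a = (if a = 0 then b else c)" for a b c :: nat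
    by (cases a) auto
  ultimately have "cmp 3 (\<lambda>xs. if xs ! 0 = 0 then xs ! 1 else xs ! 2)" by (simp only:)
  \<comment> \<open>Subtraction is truncated, so the sum of the two differences vanishes exactly at
    equality.\<close>
  then have "cmp k (\<lambda>xs. if (f xs - g xs) + (g xs - f xs) = 0 then h xs else i xs)"
    by (rule cmp_comp3[where F = "\<lambda>a b c. if a = 0 then b else c"])
      (intro cmp_add cmp_diff assms)+
  then show ?thesis
    by (rule cmp_cong) auto
qed

lemma cmp_triangle:
  assumes "cmp k f"
  shows "cmp k (\<lambda>xs. triangle (f xs))"
proof (rule cmp_comp1[OF _ assms])
  have "cmp 1 (\<lambda>xs. rec_nat 0 (\<lambda>n y. y + Suc n) (xs ! 0))"
    by (intro cmp_rec cmp_const cmp_add cmp_Suc cmp_proj) auto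
  moreover have "rec_nat 0 (\<lambda>n y. y + Suc n) a = triangle a" for a
    by (induction a) auto
  ultimately show "cmp 1 (\<lambda>xs. triangle (xs ! 0))" by simp
qed

lemma cmp_pair:
  assumes "cmp k f" "cmp k g"
  shows "cmp k (\<lambda>xs. pr (f xs) (g xs))"
  unfolding prod_encode_def by (simp add: assms cmp_add cmp_triangle)

text \<open>\<open>p1 z + p2 z\<close> is the number of the diagonal that contains \<open>z\<close> in Cantor's enumeration.\<close>

lemma diagonal_Suc:
  "p1 (Suc z) + p2 (Suc z) =
    (if Suc z = triangle (Suc (p1 z + p2 z)) then Suc (p1 z + p2 z) else p1 z + p2 z)"
proof -
  obtain a b where ab: "prod_decode z = (a, b)" by (cases "prod_decode z")
  then have z: "z = prod_encode (a, b)" by (metis prod_decode_inverse)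
  show ?thesis
  proof (cases b)
    case 0
    then have "Suc z = prod_encode (0, Suc a)" using z by (simp add: prod_encode_def)
    then have "prod_decode (Suc z) = (0, Suc a)" by simp
    then show ?thesis using ab 0 z by (simp add: prod_encode_def)
  next
    case (Suc c)
    then have "Suc z = prod_encode (Suc a, c)" using z by (simp add: prod_encode_def)
    then have "prod_decode (Suc z) = (Suc a, c)" by simp
    then show ?thesis using ab Suc z by (simp add: prod_encode_def)
  qed
qed

text \<open>By \<open>diagonal_Suc\<close> the diagonal number obeys a primitive recursion, so
  unpairing requires no search.\<close>

lemma cmp_diagonal:
  assumes "cmp k f"
  shows "cmp k (\<lambda>xs. p1 (f xs) + p2 (f xs))"
proof (rule cmp_comp1[OF _ assms])
  let ?H = "\<lambda>n y. if Suc n = triangle (Suc y) then Suc y else y"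
  have "cmp 1 (\<lambda>xs. rec_nat 0 ?H (xs ! 0))"
    by (intro cmp_rec cmp_const cmp_if_eq cmp_triangle cmp_Suc cmp_proj) auto
  moreover have "rec_nat 0 ?H z = p1 z + p2 z" for z
  proof (induction z)
    case 0
    have "prod_decode 0 = (0, 0)"
      using prod_encode_inverse[of "(0, 0)"] by (simp add: prod_encode_def)
    then show ?case by simp
  next
    case (Suc z)
    then show ?case by (simp only: diagonal_Suc nat.rec)
  qed
  ultimately show "cmp 1 (\<lambda>xs. p1 (xs ! 0) + p2 (xs ! 0))" by simp
qed

lemma cmp_fst:
  assumes "cmp k f"
  shows "cmp k (\<lambda>xs. p1 (f xs))"
proof -
  \<comment> \<open>\<open>p1 z\<close> is the offset of \<open>z\<close> from the first entry of
    its diagonal.\<close>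
  have "z - triangle (p1 z + p2 z) = p1 z" for z
    using prod_decode_inverse[of z] by (cases "prod_decode z") (auto simp: prod_encode_def)
  moreover have "cmp k (\<lambda>xs. f xs - triangle (p1 (f xs) + p2 (f xs)))"
    by (intro cmp_diff cmp_triangle cmp_diagonal assms)
  ultimately show ?thesis by simp
qed

lemma cmp_snd:
  assumes "cmp k f"
  shows "cmp k (\<lambda>xs. p2 (f xs))"
  using cmp_diff[OF cmp_diagonal[OF assms] cmp_fst[OF assms]] by simp

lemmas cmp_intros =
  cmp_const cmp_Suc cmp_add cmp_diff cmp_if_eq cmp_pair cmp_fst cmp_snd

section \<open>A stack machine for primitive recursive functions\<close>

text \<open>
  A state is \<open>pr k v\<close> with a stack \<open>k\<close> of instructions (\<open>0\<close> when empty) and a current value \<open>v\<close>. An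
  instruction \<open>pr t m\<close> stands for a unary function to be applied to the current value:
  successor, projections (tags 1 to 3), composition \<open>f \<circ> g\<close> with \<open>m = pr g f\<close> (4),
  pairing \<open>v \<mapsto> pr (f v) (g v)\<close> with \<open>m = pr f g\<close> (5), and primitive recursion (6). The instructions
  with tags 7, 8 (pending parts of a pairing) and 9 (a loop at index \<open>i\<close> with \<open>j\<close> rounds
  to go) are pushed by the machine itself. Every other tag is the zero function, so that every
  number is an instruction.
\<close>

definition act :: "nat \<Rightarrow> nat \<Rightarrow> nat \<Rightarrow> nat \<Rightarrow> nat" where
  "act t m k v =
    (if t = 1 then pr k (Suc v)
     else if t = 2 then pr k (p1 v)
     else if t = 3 then pr k (p2 v)
     else if t = 4 then pr (Suc (pr (p1 m) (Suc (pr (p2 m) k)))) v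
     else if t = 5 then pr (Suc (pr (p1 m) (Suc (pr (pr 7 (pr (p2 m) v)) k)))) v
     else if t = 6 then
       pr (Suc (pr (p1 m) (Suc (pr (pr 9 (pr (p2 m) (pr 0 v))) k)))) (p2 v)
     else if t = 7 then pr (Suc (pr (p1 m) (Suc (pr (pr 8 v) k)))) (p2 m)
     else if t = 8 then pr k (pr m v)
     else if t = 9 then
       (let g = p1 m; i = p1 (p2 m); j = p1 (p2 (p2 m)); x = p2 (p2 (p2 m))
        in if j = 0 then pr k v
           else pr (Suc (pr g (Suc (pr (pr 9 (pr g (pr (Suc i) (pr (j - 1) x)))) k))))
             (pr i (pr v x)))
     else pr k 0)"

text \<open>A nonempty stack is \<open>Suc (pr e k)\<close>, so \<open>p1 s - 1\<close> exposes the
  top instruction and the rest. Halted states are fixed points, which makes running too long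
  harmless.\<close>

definition step :: "nat \<Rightarrow> nat" where
  "step s = (if p1 s = 0 then s
     else act (p1 (p1 (p1 s - 1))) (p2 (p1 (p1 s - 1))) (p2 (p1 s - 1)) (p2 s))"

lemma step_push: "step (pr (Suc (pr (pr t m) k)) v) = act t m k v"
  by (simp add: step_def)

lemma cmp_step:
  assumes "cmp k f"
  shows "cmp k (\<lambda>xs. step (f xs))"
  unfolding step_def act_def Let_def by (intro cmp_intros assms)

lemma cmp_funpow_step:
  assumes "cmp k N" "cmp k f"
  shows "cmp k (\<lambda>xs. (step ^^ N xs) (f xs))"
proof -
  have "cmp k (\<lambda>xs. rec_nat (f xs) (\<lambda>n y. step y) (N xs))"
    by (intro cmp_rec assms cmp_step cmp_proj) simp
  moreover have "rec_nat y (\<lambda>n y. step y) n = (step ^^ n) y" for n y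
    by (induction n) auto
  ultimately show ?thesis by simp
qed

section \<open>Reachability and correctness of the instructions\<close>

definition reach :: "nat \<Rightarrow> nat \<Rightarrow> bool" where
  "reach s t \<longleftrightarrow> (\<exists>n. (step ^^ n) s = t)"

lemma reach_refl: "reach s s"
  unfolding reach_def by (rule exI[of _ 0]) simp

lemma reach_trans: "reach s t \<Longrightarrow> reach t u \<Longrightarrow> reach s u"
  unfolding reach_def by (metis comp_apply funpow_add)

lemma reach_step: "reach (step s) t \<Longrightarrow> reach s t"
  unfolding reach_def by (metis comp_apply funpow_Suc_right)

text \<open>Quantifying over the remaining stack \<open>k\<close> makes correctness compositional:
  code runs the same way above any pending instructions.\<close>

definition computes :: "nat \<Rightarrow> (nat \<Rightarrow> nat) \<Rightarrow> bool" where
  "computes e F \<longleftrightarrow> (\<forall>k v. reach (pr (Suc (pr e k)) v) (pr k (F v)))"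

lemma computesD: "computes e F \<Longrightarrow> reach (pr k (F v)) t \<Longrightarrow> reach (pr (Suc (pr e k)) v) t"
  unfolding computes_def by (blast intro: reach_trans)

lemma computesI:
  "(\<And>k v. reach (act t m k v) (pr k (F v))) \<Longrightarrow> computes (pr t m) F"
  unfolding computes_def step_push[symmetric] using reach_step by blast

lemma computes_zero: "t \<notin> {1..9} \<Longrightarrow> computes (pr t m) (\<lambda>_. 0)"
  by (rule computesI) (auto simp: act_def reach_refl)

lemma computes_Suc: "computes (pr 1 m) Suc"
  by (rule computesI) (simp add: act_def reach_refl)

lemma computes_fst: "computes (pr 2 m) p1"
  by (rule computesI) (simp add: act_def reach_refl)

lemma computes_snd: "computes (pr 3 m) p2"
  by (rule computesI) (simp add: act_def reach_refl)

lemma computes_comp: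
  assumes "computes f F" "computes g G"
  shows "computes (pr 4 (pr g f)) (\<lambda>v. F (G v))"
  by (rule computesI) (auto simp: act_def intro!: computesD[OF assms(1)] computesD[OF assms(2)] reach_refl)

text \<open>Tag 7 keeps the second function and the original input while the first component is
  computed; tag 8 then keeps that component.\<close>

lemma computes_pair_second: "computes (pr 8 y) (\<lambda>v. pr y v)"
  by (rule computesI) (simp add: act_def reach_refl)

lemma computes_pair_first:
  assumes "computes g G"
  shows "computes (pr 7 (pr g x)) (\<lambda>v. pr v (G x))"
  by (rule computesI)
    (auto simp: act_def intro!: computesD[OF assms] computesD[OF computes_pair_second] reach_refl)

lemma computes_pair:
  assumes "computes f F" "computes g G"
  shows "computes (pr 5 (pr f g)) (\<lambda>v. pr (F v) (G v))"
  by (rule computesI)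
    (auto simp: act_def intro!: computesD[OF assms(1)]
      computesD[OF computes_pair_first[OF assms(2)]] reach_refl)

lemma computes_loop:
  assumes "computes g G"
  shows "computes (pr 9 (pr g (pr i (pr j x))))
    (\<lambda>v. rec_nat v (\<lambda>n y. G (pr (i + n) (pr y x))) j)"
proof (induction j arbitrary: i)
  case 0
  show ?case by (rule computesI) (simp add: act_def reach_refl)
next
  case (Suc j)
  \<comment> \<open>The machine performs the first round first, whereas \<open>rec_nat\<close>
    unfolds at the last one.\<close>
  have shift: "rec_nat (G (pr i (pr v x))) (\<lambda>n y. G (pr (Suc i + n) (pr y x))) j =
    rec_nat v (\<lambda>n y. G (pr (i + n) (pr y x))) (Suc j)" for v
    by (induction j) auto
  show ?case
    unfolding shift[symmetric]
    by (rule computesI)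
      (auto simp: act_def intro!: computesD[OF assms] computesD[OF Suc.IH] reach_refl)
qed

lemma computes_rec:
  assumes "computes f F" "computes g G"
  shows "computes (pr 6 (pr f g))
    (\<lambda>v. rec_nat (F (p2 v)) (\<lambda>n y. G (pr n (pr y (p2 v)))) (p1 v))"
proof (rule computesI)
  fix k v
  \<comment> \<open>The input \<open>v\<close> already codes the pair of round count
    \<open>p1 v\<close> and parameter \<open>p2 v\<close> that the loop expects.\<close>
  have "computes (pr 9 (pr g (pr 0 v)))
    (\<lambda>z. rec_nat z (\<lambda>n y. G (pr n (pr y (p2 v)))) (p1 v))"
    using computes_loop[OF assms(2), of 0 "p1 v" "p2 v"] by simp
  then show "reach (act 6 (pr f g) k v)
    (pr k (rec_nat (F (p2 v)) (\<lambda>n y. G (pr n (pr y (p2 v)))) (p1 v)))"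
    by (auto simp: act_def intro!: computesD[OF assms(1)] elim!: computesD intro: reach_refl)
qed

text \<open>Strong induction on the code, whose components are smaller. Totality is what later
  permits minimization over halting times.\<close>

lemma computes_total: "\<exists>F. computes e F"
proof (induction e rule: less_induct)
  case (less e)
  obtain t m where e: "e = pr t m" by (metis prod_decode_inverse surj_pair)
  obtain a b where m: "m = pr a b" by (metis prod_decode_inverse surj_pair)
  obtain i c where b: "b = pr i c" by (metis prod_decode_inverse surj_pair)
  obtain j x where c: "c = pr j x" by (metis prod_decode_inverse surj_pair)
  show ?case
  proof (cases "t \<in> {1..9}")
    case False
    then show ?thesis using computes_zero e by blast
  next
    case True
    \<comment> \<open>A positive tag makes this strict; \<open>pr 0 0 = 0\<close> shows that tag 0
      would not.\<close>
    then have "m < e" unfolding e prod_encode_def by (cases t) auto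
    then have "a < e" "b < e"
      using le_prod_encode_1[of a b] le_prod_encode_2[of b a] unfolding m by auto
    then obtain F G where FG: "computes a F" "computes b G" using less.IH by blast
    have "t = 1 \<or> t = 2 \<or> t = 3 \<or> t = 4 \<or> t = 5 \<or> t = 6 \<or> t = 7 \<or> t = 8 \<or> t = 9"
      using True by auto
    then show ?thesis
      unfolding e
    proof (elim disjE)
      assume "t = 9"
      then show "\<exists>F. computes (pr t m) F"
        unfolding m b c using computes_loop[OF FG(1)] by blast
    qed (use computes_Suc computes_fst computes_snd computes_pair_second computes_comp[OF FG(2,1)]
        computes_pair[OF FG] computes_rec[OF FG] computes_pair_first[OF FG(1)] m in blast)+
  qed
qed

section \<open>Determinism and the universal evaluator\<close>

lemma funpow_step_halted: "p1 s = 0 \<Longrightarrow> (step ^^ n) s = s"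
  by (induction n) (auto simp: step_def)

lemma reach_halted_unique:
  assumes "reach s t" "p1 t = 0" "reach s u" "p1 u = 0"
  shows "t = u"
proof -
  obtain a b where ab: "(step ^^ a) s = t" "(step ^^ b) s = u"
    using assms unfolding reach_def by blast
  \<comment> \<open>Both runs are padded to a common length, since halted states do not
    change.\<close>
  have "(step ^^ (a + b)) s = t" "(step ^^ (a + b)) s = u"
    using ab assms funpow_step_halted by (metis add.commute comp_apply funpow_add)+
  then show ?thesis by simp
qed

definition run :: "nat \<Rightarrow> nat \<Rightarrow> nat" where
  "run e v = (let s = pr (Suc (pr e 0)) v
    in p2 ((step ^^ (LEAST n. p1 ((step ^^ n) s) = 0)) s))"

lemma halts: "\<exists>n. p1 ((step ^^ n) (pr (Suc (pr e 0)) v)) = 0"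
proof -
  obtain F where "computes e F" using computes_total by blast
  then obtain n where "(step ^^ n) (pr (Suc (pr e 0)) v) = pr 0 (F v)"
    unfolding computes_def reach_def by blast
  then show ?thesis by (intro exI[of _ n]) simp
qed

lemma run_computes:
  assumes "computes e F"
  shows "run e v = F v"
proof -
  define s where "s = pr (Suc (pr e 0)) v"
  define n where "n = (LEAST n. p1 ((step ^^ n) s) = 0)"
  have "p1 ((step ^^ n) s) = 0"
    unfolding n_def s_def by (rule LeastI_ex[OF halts])
  moreover have "reach s ((step ^^ n) s)" unfolding reach_def by blast
  moreover have "reach s (pr 0 (F v))"
    using assms unfolding computes_def s_def by blast
  ultimately have "(step ^^ n) s = pr 0 (F v)"
    using reach_halted_unique[of s "(step ^^ n) s" "pr 0 (F v)"] by simp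
  then show ?thesis by (simp add: run_def flip: s_def n_def)
qed

text \<open>The search for the halting time is the only use of minimization.\<close>

lemma cmp_run:
  assumes "cmp k f" "cmp k g"
  shows "cmp k (\<lambda>xs. run (f xs) (g xs))"
proof (rule cmp_comp2[OF _ assms])
  let ?s = "\<lambda>xs. pr (Suc (pr (xs ! 0) 0)) (xs ! 1)"
  have "cmp 2 (\<lambda>xs. LEAST n. p1 ((step ^^ n) (?s xs)) = 0)"
  proof (rule cmp_Least)
    have "cmp (Suc 2) (\<lambda>zs. p1 ((step ^^ (zs ! 0)) (pr (Suc (pr (zs ! 1) 0)) (zs ! 2))))"
      by (intro cmp_intros cmp_funpow_step cmp_proj) auto
    then show "cmp (Suc 2) (\<lambda>zs. p1 ((step ^^ (zs ! 0)) (?s (tl zs))))"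
      by (rule cmp_cong) (auto simp: nth_tl numeral_2_eq_2)
  qed (rule halts)
  then show "cmp 2 (\<lambda>xs. run (xs ! 0) (xs ! 1))"
    unfolding run_def Let_def by (intro cmp_intros cmp_funpow_step cmp_proj) auto
qed

section \<open>Codes of primitive recursive functions\<close>

definition coded :: "(nat \<Rightarrow> nat) \<Rightarrow> bool" where
  "coded F \<longleftrightarrow> (\<exists>e. computes e F)"

lemma coded_comp: "coded F \<Longrightarrow> coded G \<Longrightarrow> coded (\<lambda>v. F (G v))"
  unfolding coded_def using computes_comp by blast

lemma coded_pair: "coded F \<Longrightarrow> coded G \<Longrightarrow> coded (\<lambda>v. pr (F v) (G v))"
  unfolding coded_def using computes_pair by blast

lemma coded_fst: "coded F \<Longrightarrow> coded (\<lambda>v. p1 (F v))"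
  using coded_comp computes_fst unfolding coded_def by blast

lemma coded_snd: "coded F \<Longrightarrow> coded (\<lambda>v. p2 (F v))"
  using coded_comp computes_snd unfolding coded_def by blast

lemma coded_Suc: "coded F \<Longrightarrow> coded (\<lambda>v. Suc (F v))"
  using coded_comp computes_Suc unfolding coded_def by blast

text \<open>No instruction is the identity, but pairing the two projections restores the
  input.\<close>

lemma coded_id: "coded (\<lambda>v. v)"
proof -
  have "coded (\<lambda>v. pr (p1 v) (p2 v))"
    using coded_pair computes_fst computes_snd unfolding coded_def by blast
  then show ?thesis by simp
qed

lemma coded_const: "coded (\<lambda>_. n)"
proof (induction n)
  case 0
  show ?case unfolding coded_def using computes_zero[of 0] by auto
next
  case (Suc n)
  then show ?case by (rule coded_Suc)
qed

lemma coded_rec: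
  "coded F \<Longrightarrow> coded G \<Longrightarrow>
    coded (\<lambda>v. rec_nat (F (p2 v)) (\<lambda>n y. G (pr n (pr y (p2 v)))) (p1 v))"
  unfolding coded_def using computes_rec by blast

text \<open>Prepending an argument is a single pairing, which matches the input format of
  \<open>coded_rec\<close>.\<close>

fun tuple :: "nat list \<Rightarrow> nat" where
  "tuple [] = 0"
| "tuple (x # xs) = pr x (tuple xs)"

lemma coded_nth: "\<exists>F. coded F \<and> (\<forall>xs. i < length xs \<longrightarrow> F (tuple xs) = xs ! i)"
proof (induction i)
  case 0
  have "p1 (tuple xs) = xs ! 0" if "0 < length xs" for xs
    using that by (cases xs) auto
  then show ?case using coded_fst[OF coded_id] by blast
next
  case (Suc i)
  then obtain F where F: "coded F" "\<And>xs. i < length xs \<Longrightarrow> F (tuple xs) = xs ! i" by blast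
  have "F (p2 (tuple xs)) = xs ! Suc i" if "Suc i < length xs" for xs
    using that F(2) by (cases xs) auto
  then show ?case using coded_comp[OF F(1) coded_snd[OF coded_id]] by blast
qed

lemma primrec_fn_coded:
  "primrec_fn k f \<Longrightarrow> \<exists>F. coded F \<and> (\<forall>xs. length xs = k \<longrightarrow> F (tuple xs) = f xs)"
proof (induction rule: primrec_fn.induct)
  case (zero k)
  show ?case using coded_const[of 0] by blast
next
  case succ
  have "Suc (p1 (tuple xs)) = Suc (hd xs)" if "length xs = 1" for xs
    using that by (cases xs) auto
  then show ?case using coded_Suc[OF coded_fst[OF coded_id]] by blast
next
  case (proj i k)
  then show ?case using coded_nth[of i] by auto
next
  case (comp fs g k)
  obtain G where G: "coded G" "\<And>xs. length xs = length fs \<Longrightarrow> G (tuple xs) = g xs"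
    using comp.IH by blast
  \<comment> \<open>The inner functions are first combined into one function that produces the whole
    argument tuple.\<close>
  have "\<exists>F. coded F \<and> (\<forall>xs. length xs = k \<longrightarrow> F (tuple xs) = tuple (map (\<lambda>f. f xs) fs))"
    using comp.IH(2)
  proof (induction fs)
    case Nil
    show ?case using coded_const[of 0] by auto
  next
    case (Cons f fs)
    obtain F where F: "coded F" "\<And>xs. length xs = k \<Longrightarrow> F (tuple xs) = tuple (map (\<lambda>f. f xs) fs)"
      using Cons by auto
    obtain H where H: "coded H" "\<And>xs. length xs = k \<Longrightarrow> H (tuple xs) = f xs"
      using Cons.prems by auto
    show ?case using coded_pair[OF H(1) F(1)] F(2) H(2) by (intro exI conjI) auto
  qed
  then obtain F where F: "coded F"
    "\<And>xs. length xs = k \<Longrightarrow> F (tuple xs) = tuple (map (\<lambda>f. f xs) fs)" by blast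
  show ?case using coded_comp[OF G(1) F(1)] F(2) G(2) by (intro exI conjI) auto
next
  case (prec k g h)
  obtain G where G: "coded G" "\<And>xs. length xs = k \<Longrightarrow> G (tuple xs) = g xs"
    using prec.IH(1) by blast
  obtain H where H: "coded H" "\<And>xs. length xs = Suc (Suc k) \<Longrightarrow> H (tuple xs) = h xs"
    using prec.IH(2) by blast
  let ?R = "\<lambda>v. rec_nat (G (p2 v)) (\<lambda>n y. H (pr n (pr y (p2 v)))) (p1 v)"
  have "?R (tuple xs) = rec_nat (g (tl xs)) (\<lambda>n y. h (n # y # tl xs)) (hd xs)"
    if len: "length xs = Suc k" for xs
  proof -
    obtain x ys where xs: "xs = x # ys" "length ys = k"
      using len by (cases xs) auto
    have "H (pr n (pr y (tuple ys))) = h (n # y # ys)" for n y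
      using H(2)[of "n # y # ys"] xs by simp
    then show ?thesis using xs G(2) by simp
  qed
  then show ?case using coded_rec[OF G(1) H(1)] by blast
qed

definition diag :: "nat set" where
  "diag = {n. run n n = 0}"

text \<open>A code \<open>e\<close> of the characteristic function would contradict the definition
  of \<open>diag\<close> at input \<open>e\<close>.\<close>

lemma diag_not_coded: "\<not> coded (\<lambda>n. of_bool (n \<in> diag))"
proof
  assume "coded (\<lambda>n. of_bool (n \<in> diag))"
  then obtain e where "computes e (\<lambda>n. of_bool (n \<in> diag))" unfolding coded_def by blast
  then have "run e e = of_bool (e \<in> diag)" by (rule run_computes)
  then show False by (cases "e \<in> diag") (auto simp: diag_def)
qed

section \<open>The prefix tree\<close>

text \<open>As a recursion on \<open>n\<close>, the query code becomes accessible to both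
  \<open>cmp_rec\<close> and \<open>coded_rec\<close>.\<close>

lemma list_encode_replicate_append:
  "list_encode (replicate n r @ ys) = rec_nat (list_encode ys) (\<lambda>_ y. Suc (pr r y)) n"
  by (induction n) auto

lemma cmp_list_encode_replicate_append:
  assumes "cmp k f"
  shows "cmp k (\<lambda>xs. list_encode (replicate (f xs) r @ ys))"
  unfolding list_encode_replicate_append
  by (intro cmp_rec assms cmp_intros cmp_proj) auto

lemma coded_list_encode_replicate_append:
  "coded (\<lambda>n. list_encode (replicate n r @ ys))"
proof -
  \<comment> \<open>\<open>p1 (p2 _)\<close> extracts the accumulator \<open>y\<close> from the loop
    input; the parameter is a dummy, later set to 0.\<close>
  have "coded (\<lambda>v. rec_nat (list_encode ys) (\<lambda>n y. Suc (pr r (p1 (p2 (pr n (pr y (p2 v))))))) (p1 v))"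
    by (rule coded_rec[of "\<lambda>_. list_encode ys" "\<lambda>v. Suc (pr r (p1 (p2 v)))"])
      (intro coded_const coded_Suc coded_pair coded_fst coded_snd coded_id)+
  then have "coded (\<lambda>v. list_encode (replicate (p1 v) r @ ys))"
    by (simp add: list_encode_replicate_append)
  from coded_comp[OF this coded_pair[OF coded_id coded_const[of 0]]]
  show ?thesis by simp
qed

text \<open>Index \<open>i\<close> has arity \<open>Suc i\<close>. Requiring
  \<open>i = Suc n\<close> keeps \<open>[1]\<close> out of the unary relation, which must contain
  only the root.\<close>

definition diag_tree :: "nat struct" where
  "diag_tree = \<lparr>univ = UNIV,
     rel = (\<lambda>i. {xs. xs = replicate (Suc i) 0 \<or>
       (\<exists>n \<in> diag. i = Suc n \<and> xs = replicate i 0 @ [1])}),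
     cst = 0\<rparr>"

lemma prefix_tree_diag_tree: "prefix_tree diag_tree"
proof -
  have "take (Suc i) xs \<in> rel diag_tree i" if "xs \<in> rel diag_tree n" "i \<le> n" for n xs i
  proof (cases "i = n")
    case True
    then show ?thesis using that by (auto simp: diag_tree_def)
  next
    case False
    \<comment> \<open>A proper prefix loses the final 1 and consists of zeros only.\<close>
    then show ?thesis using that by (auto simp: diag_tree_def min_def simp flip: replicate_Suc)
  qed
  then show ?thesis
    unfolding prefix_tree_def is_struct_def by (auto simp: diag_tree_def)
qed

lemma computable_struct_diag_tree: "computable_struct Suc diag_tree"
proof -
  \<comment> \<open>\<open>xs ! 0\<close> is the relation index, so \<open>xs ! 0 - 1\<close> is the
    candidate for \<open>diag\<close>; the \<open>@ []\<close> fits the shape of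
    \<open>cmp_list_encode_replicate_append\<close>.\<close>
  let ?c = "\<lambda>xs. if xs ! 1 = list_encode (replicate (Suc (xs ! 0)) 0 @ []) then 1
    else if xs ! 0 = 0 then 0
    else if run (xs ! 0 - 1) (xs ! 0 - 1) = 0 then
      if xs ! 1 = list_encode (replicate (xs ! 0) 0 @ [1]) then 1 else 0
    else 0"
  have "cmp 2 ?c"
    by (intro cmp_intros cmp_list_encode_replicate_append cmp_run cmp_proj) auto
  moreover have "?c [i, list_encode xs] = of_bool (xs \<in> rel diag_tree i)" for i xs
    by (cases i) (auto simp: diag_tree_def diag_def list_encode_eq simp del: list_encode.simps replicate_Suc)
  ultimately have "\<exists>c. computable_fn 2 c \<and> (\<forall>i xs. length xs = Suc i \<longrightarrow>
      c [i, list_encode xs] = of_bool (xs \<in> rel diag_tree i))"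
    unfolding cmp_def by (metis length_Cons list.size(3) numeral_2_eq_2)
  moreover have "\<exists>d. computable_fn 1 d \<and> (\<forall>x. d [x] = of_bool (x \<in> univ diag_tree))"
    using cmp_const[of 1 1] unfolding cmp_def by (auto simp: diag_tree_def)
  ultimately show ?thesis
    using prefix_tree_diag_tree unfolding computable_struct_def prefix_tree_def by blast
qed

lemma diag_tree_not_punctual:
  assumes "punctual_struct Suc B" "struct_iso Suc diag_tree B"
  shows False
proof -
  obtain h where h: "\<And>i xs. length xs = Suc i \<Longrightarrow> xs \<in> rel diag_tree i \<longleftrightarrow> map h xs \<in> rel B i"
    using assms(2) unfolding struct_iso_def diag_tree_def by auto
  obtain c where c: "primrec_fn 2 c"
    "\<And>i xs. length xs = Suc i \<Longrightarrow> c [i, list_encode xs] = of_bool (xs \<in> rel B i)"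
    using assms(1) unfolding punctual_struct_def by blast
  obtain C where C: "coded C" "\<And>xs. length xs = 2 \<Longrightarrow> C (tuple xs) = c xs"
    using primrec_fn_coded[OF c(1)] by blast
  let ?q = "\<lambda>n. list_encode (replicate (Suc n) (h 0) @ [h 1])"
  have "coded ?q"
    by (rule coded_comp[OF coded_list_encode_replicate_append coded_Suc[OF coded_id]])
  \<comment> \<open>The argument of \<open>C\<close> is \<open>tuple [Suc n, ?q n]\<close>.\<close>
  then have "coded (\<lambda>n. C (pr (Suc n) (pr (?q n) 0)))"
    by (intro coded_comp[OF C(1)] coded_pair coded_Suc coded_id coded_const)
  moreover have "C (pr (Suc n) (pr (?q n) 0)) = of_bool (n \<in> diag)" for n
  proof -
    let ?w = "replicate (Suc n) 0 @ [1 :: nat]"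
    \<comment> \<open>This excludes the all-zero alternative, so membership of \<open>?w\<close>
      depends on \<open>diag\<close> alone.\<close>
    have "?w \<noteq> replicate (Suc (Suc n)) 0"
      by (metis last_replicate last_snoc nat.distinct(1) zero_neq_one)
    then have "n \<in> diag \<longleftrightarrow> ?w \<in> rel diag_tree (Suc n)"
      by (simp add: diag_tree_def)
    also have "\<dots> \<longleftrightarrow> map h ?w \<in> rel B (Suc n)"
      by (rule h) simp
    finally have "c [Suc n, ?q n] = of_bool (n \<in> diag)"
      by (subst c(2)) auto
    then show ?thesis using C(2)[of "[Suc n, ?q n]"] by simp
  qed
  ultimately show False using diag_not_coded by simp
qed

theorem theorem32:
  "\<not> punctually_robust Suc {A. prefix_tree A \<and> infinite (univ A)} \<and>
   (\<exists>A :: nat struct. prefix_tree A \<and> infinite (univ A) \<and> computable_struct Suc A \<and>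
     \<not> (\<exists>B :: nat struct. prefix_tree B \<and> punctual_struct Suc B \<and> struct_iso Suc A B))"
proof -
  have "infinite (univ diag_tree)" by (simp add: diag_tree_def)
  then show ?thesis
    unfolding punctually_robust_def
    using prefix_tree_diag_tree computable_struct_diag_tree diag_tree_not_punctual by blast
qed

end
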